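(* The algorithm described in the context (the $\epsilon$-adaptive multiscale scan) requires on the order of $$\max\big\{n^d,\ \epsilon^{-4d}(n/\underline h)^d\log n\big\}$$ basic operations.
   Context: The dimension $d\ge1$ is fixed (constants in the order bound may depend on $d$) and $n$ is a power of $2$; $[k]=\{1,\dots,k\}$, $\circ$ is the componentwise product, $\mathbf e_j$ is the $j$th canonical basis vector, $\mathbf 1$ is the all-ones vector, $2^{\mathbf a}=(2^{a_1},\dots,2^{a_d})$, $[n/2^{\mathbf a}]=\times_j[n/2^{a_j}]$. Input: a real field $y$ over $[n]^d$; integers $1\le\underline h\le\overline h\le n$; $\epsilon>0$ with $\epsilon^2\underline h\ge8d$; P-value functions $\hat\alpha_{\mathbf h}:\mathbb R\to[0,1]$ indexed by shapes $\mathbf h$ (each evaluation counts as a basic operation). Algorithm: (1) Initialize $\mathrm{dyad}_{\mathbf 1}(\mathbf i)=y(\mathbf i)$ for $\mathbf i\in[n]^d$. (2) For each $\mathbf a\in[\log_2n]^d\setminus\{\mathbf 1\}$ (in an order such that needed earlier arrays are available), let $j'=\min\{j\in[d]:a_j>1\}$, and for each $\mathbf t\in[n/2^{\mathbf a}]$ set $\mathrm{dyad}_{\mathbf a}(\mathbf t)=\mathrm{dyad}_{\mathbf a-\mathbf e_{j'}}(\mathbf t\circ(\mathbf 1+\mathbf e_{j'}))+\mathrm{dyad}_{\mathbf a-\mathbf e_{j'}}(\mathbf t\circ(\mathbf 1+\mathbf e_{j'})-\mathbf e_{j'})$. (3) Set $\underline a=\lfloor\log_2(\epsilon^2\underline h/(4d))\rfloor$,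 $\overline a=\lceil\log_2(\epsilon^2\overline h/(4d))\rceil$, and $\hat\alpha=1$. (4) For each integer vector $\mathbf a\in[\underline a,\overline a]^d$ and each $\mathbf f\in[\lceil8d/\epsilon^2\rceil]^d$: compute $\hat s=\big(\prod_jf_j2^{a_j}\big)^{-1/2}\max_{\mathbf t\in[n/2^{\mathbf a}]}(\mathrm{dyad}_{\mathbf a}\ast b_{\mathbf f})(\mathbf t)$, and then set $\hat\alpha\leftarrow\min\{\hat\alpha,\hat\alpha_{\mathbf f\circ2^{\mathbf a}}(\hat s)\}$. (5) Output $\hat\alpha$. Here $b_{\mathbf f}(\mathbf i)=\prod_jI\{i_j\le f_j\}$ is the boxcar function of shape $\mathbf f$ and $(g\ast b_{\mathbf f})(\mathbf t)=\sum_{\mathbf i\in[\mathbf f]}g(\mathbf i+\mathbf t)$, with $[\mathbf f]=\times_j[f_j]$. Each convolution is computed with the Fast Fourier Transform, at a cost of $O(N\log n)$ basic operations on a grid with $N$ nodes.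
   Formalization: The upper bound's constant is uniform only for ε ≤ E (E arbitrary) and may depend on E: uniformity over all ε fails, e.g. d = 1, lower h = 1, ε⁴ = log n. The matching lower bound also assumes that the FFT costs at least a constant times N log n. *)

theory Defs
  imports Complex_Main "HOL-Library.Monad_Syntax"
begin

section \<open>Computations with an operation count\<close>

text \<open>Real-RAM model: real and integer arithmetic (including powers, square roots, logarithms and
  rounding), comparisons, reading or writing one array cell and evaluating one P-value function
  each cost one unit.  A computation carries its result and the number of units spent on it.\<close>

datatype 'a counted = Counted (result: 'a) (ops: nat)

definition counted_bind :: "'a counted \<Rightarrow> ('a \<Rightarrow> 'b counted) \<Rightarrow> 'b counted" where
  "counted_bind c g = Counted (result (g (result c))) (ops c + ops (g (result c)))"

adhoc_overloading Monad_Syntax.bind \<rightleftharpoons> counted_bind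

abbreviation counted_return :: "'a \<Rightarrow> 'a counted" where
  "counted_return x \<equiv> Counted x 0"

text \<open>\<open>spend k x\<close> delivers the value of the expression \<open>x\<close>, whose evaluation takes \<open>k\<close> units.\<close>

definition spend :: "nat \<Rightarrow> 'a \<Rightarrow> 'a counted" where
  "spend k x = Counted x k"

text \<open>A loop over multi-indices; advancing to the next multi-index may touch every coordinate.\<close>

fun for_each :: "nat list list \<Rightarrow> (nat list \<Rightarrow> 's \<Rightarrow> 's counted) \<Rightarrow> 's \<Rightarrow> 's counted" where
  "for_each [] body s = counted_return s"
| "for_each (i # is) body s = do {
     _ \<leftarrow> spend (length i) ();
     s' \<leftarrow> body i s;
     for_each is body s'
   }"


section \<open>Multi-indices and arrays\<close>

text \<open>Multi-indices are lists of length \<open>d\<close> with 1-based entries, but their coordinates are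
  numbered \<open>0, \<dots>, d - 1\<close>.  \<open>box k\<close> enumerates \<open>[k\<^sub>1] \<times> \<dots> \<times> [k\<^sub>d]\<close>.\<close>

type_synonym array = "nat list \<Rightarrow> real"

definition box :: "nat list \<Rightarrow> nat list list" where
  "box ks = product_lists (map (\<lambda>k. [1..<Suc k]) ks)"

abbreviation ones :: "nat \<Rightarrow> nat list" where
  "ones d \<equiv> replicate d 1"

definition coarse_grid :: "nat \<Rightarrow> nat list \<Rightarrow> nat list" where
  "coarse_grid n a = map (\<lambda>k. n div 2 ^ k) a"

text \<open>The grid on which \<open>dyad\<^sub>a\<close> is stored: \<open>[n/2\<^sup>a]\<close>, except that \<open>dyad\<^sub>1\<close> is the
  input field on all of \<open>[n]\<^sup>d\<close>.\<close>

definition dyad_grid :: "nat \<Rightarrow> nat list \<Rightarrow> nat list" where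
  "dyad_grid n a = (if a = ones (length a) then replicate (length a) n else coarse_grid n a)"

text \<open>The store maps a level \<open>a\<close> to the array \<open>dyad\<^sub>a\<close>.\<close>

type_synonym store = "nat list \<Rightarrow> array"

definition read_cell :: "store \<Rightarrow> nat list \<Rightarrow> nat list \<Rightarrow> real counted" where
  "read_cell M a t = spend 1 (M a t)"

definition write_cell :: "store \<Rightarrow> nat list \<Rightarrow> nat list \<Rightarrow> real \<Rightarrow> store counted" where
  "write_cell M a t v = spend 1 (M(a := (M a)(t := v)))"


section \<open>The dyadic sums\<close>

definition init_dyad :: "nat \<Rightarrow> nat \<Rightarrow> array \<Rightarrow> store counted" where
  "init_dyad d n y = for_each (box (replicate d n))
     (\<lambda>i M. do { v \<leftarrow> spend 1 (y i); write_cell M (ones d) i v })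
     (\<lambda>_ _. 0)"

definition first_axis :: "nat list \<Rightarrow> nat" where
  "first_axis a = (LEAST j. j < length a \<and> a ! j > 1)"

definition finer :: "nat list \<Rightarrow> nat list" where
  "finer a = a[first_axis a := a ! first_axis a - 1]"

definition aggregate :: "nat \<Rightarrow> nat list \<Rightarrow> store \<Rightarrow> store counted" where
  "aggregate n a M = do {
     j \<leftarrow> spend (length a) (first_axis a);
     b \<leftarrow> spend 1 (finer a);
     m \<leftarrow> spend (2 * length a) (coarse_grid n a);
     for_each (box m) (\<lambda>t M. do {
       t1 \<leftarrow> spend 1 (t[j := 2 * t ! j]);
       t0 \<leftarrow> spend 1 (t1[j := t1 ! j - 1]);
       u \<leftarrow> read_cell M b t1;
       v \<leftarrow> read_cell M b t0;
       w \<leftarrow> spend 1 (u + v);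
       write_cell M a t w
     }) M
   }"

text \<open>An order of the levels \<open>[log\<^sub>2 n]\<^sup>d - {1}\<close>, where \<open>n = 2\<^sup>L\<close>, in which every
  array is computed after the one it is built from.\<close>

definition valid_order :: "nat \<Rightarrow> nat \<Rightarrow> nat list list \<Rightarrow> bool" where
  "valid_order d L order \<longleftrightarrow>
     distinct order \<and> set order = set (box (replicate d L)) - {ones d} \<and>
     (\<forall>i < length order. finer (order ! i) = ones d \<or> finer (order ! i) \<in> set (take i order))"


lemma set_box: "set (box ks) = {t. length t = length ks \<and> (\<forall>j<length ks. 1 \<le> t ! j \<and> t ! j \<le> ks ! j)}"
  unfolding box_def product_lists_set
  by (auto simp: list_all2_conv_all_nth nth_append less_Suc_eq_le simp del: upt_Suc)

lemma first_axis:
  assumes "length a = d" "\<forall>j<d. 1 \<le> a ! j" "a \<noteq> ones d"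
  shows "first_axis a < length a \<and> a ! first_axis a > 1"
proof -
  have "\<exists>j. j < length a \<and> a ! j > 1"
  proof (rule ccontr)
    assume "\<not> ?thesis"
    then have "\<forall>j<d. a ! j = 1" using assms(1,2) by (metis le_antisym not_less)
    then have "a = ones d" using assms(1) by (simp add: list_eq_iff_nth_eq)
    then show False using assms(3) by simp
  qed
  then show ?thesis unfolding first_axis_def by (rule LeastI_ex)
qed

text \<open>Such an order always exists, e.g. by increasing sum of the coordinates.\<close>

lemma valid_order_exists: "\<exists>order. valid_order d L order"
proof -
  let ?S = "set (box (replicate d L)) - {ones d}"
  obtain zs where zs: "set zs = ?S" "distinct zs"
    using finite_distinct_list[of ?S] by auto
  define xs where "xs = sort_key sum_list zs"
  have xs: "set xs = ?S" "distinct xs" "sorted (map sum_list xs)"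
    unfolding xs_def using zs by simp_all
  have "finer (xs ! i) = ones d \<or> finer (xs ! i) \<in> set (take i xs)" if i: "i < length xs" for i
  proof (cases "finer (xs ! i) = ones d")
    case False
    let ?a = "xs ! i" and ?j = "first_axis (xs ! i)"
    have a: "?a \<in> ?S" using i xs(1) nth_mem by blast
    then have la: "length ?a = d" and ge: "\<forall>j<d. 1 \<le> ?a ! j" and le: "\<forall>j<d. ?a ! j \<le> L"
      by (auto simp: set_box)
    have j: "?j < length ?a" "?a ! ?j > 1"
      using first_axis[OF la ge] a by auto
    have "finer ?a \<in> ?S"
      using False la ge le j by (auto simp: set_box finer_def nth_list_update)
         (metis diff_le_self le_trans)?
    then obtain k where k: "k < length xs" "xs ! k = finer ?a"
      using xs(1) by (metis in_set_conv_nth)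
    have "sum_list (finer ?a) < sum_list ?a"
      using j elem_le_sum_list[OF j(1)] by (simp add: finer_def sum_list_update)
    then have "k < i"
      using xs(3) i k by (metis (no_types, lifting) length_map linorder_not_less nth_map sorted_nth_mono)
    then show ?thesis using k i by (metis in_set_conv_nth length_take min.absorb4 nth_take)
  qed simp
  then show ?thesis unfolding valid_order_def using xs by blast
qed


section \<open>The multiscale scan\<close>

definition box_conv :: "nat list \<Rightarrow> array \<Rightarrow> nat list \<Rightarrow> array" where
  "box_conv m g f t = (\<Sum>i\<in>set (box f).
     if map2 (+) i t \<in> set (box m) then g (map2 (+) i t) else 0)"

text \<open>The fast Fourier transform enters as a primitive: \<open>fft n m f\<close> is the number of operations
  it uses for the convolution of an array on the grid \<open>m\<close> with the boxcar of shape \<open>f\<close>, when the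
  side of the original field is \<open>n\<close>.\<close>

type_synonym fft_count = "nat \<Rightarrow> nat list \<Rightarrow> nat list \<Rightarrow> nat"

definition fft_box_conv :: "fft_count \<Rightarrow> nat \<Rightarrow> nat list \<Rightarrow> array \<Rightarrow> nat list \<Rightarrow> array counted" where
  "fft_box_conv fft n m g f = spend (fft n m f) (box_conv m g f)"

definition max_over :: "nat list list \<Rightarrow> array \<Rightarrow> real counted" where
  "max_over ts g = do {
     v \<leftarrow> spend 1 (g (hd ts));
     for_each (tl ts) (\<lambda>t x. do { w \<leftarrow> spend 1 (g t); spend 1 (max x w) }) v
   }"

definition scan_shape ::
  "fft_count \<Rightarrow> (nat list \<Rightarrow> real \<Rightarrow> real) \<Rightarrow> nat \<Rightarrow> store \<Rightarrow> nat list \<Rightarrow> nat list \<Rightarrow> real \<Rightarrow> real counted" where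
  "scan_shape fft pval n M a f p = do {
     g \<leftarrow> fft_box_conv fft n (dyad_grid n a) (M a) f;
     x \<leftarrow> max_over (box (coarse_grid n a)) g;
     h \<leftarrow> spend (2 * length a) (map2 (\<lambda>k b. k * 2 ^ b) f a);
     v \<leftarrow> spend (length a) (real (prod_list h));
     s \<leftarrow> spend 2 (x / sqrt v);
     q \<leftarrow> spend 1 (pval h s);
     spend 1 (min p q)
   }"

text \<open>Levels with an empty grid (\<open>2\<^bsup>a\<^sub>j\<^esup> > n\<close> for some \<open>j\<close>) offer no location to maximize
  over; they are tested for and skipped.\<close>

definition scan_level ::
  "fft_count \<Rightarrow> (nat list \<Rightarrow> real \<Rightarrow> real) \<Rightarrow> nat \<Rightarrow> nat \<Rightarrow> store \<Rightarrow> nat list \<Rightarrow> real \<Rightarrow> real counted" where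
  "scan_level fft pval n F M a p = do {
     e \<leftarrow> spend (3 * length a) (0 \<in> set (coarse_grid n a));
     if e then counted_return p
     else for_each (box (replicate (length a) F)) (scan_shape fft pval n M a) p
   }"

text \<open>Since \<open>\<epsilon>\<^sup>2 hlo \<ge> 8 d\<close> on all admissible inputs, both rounded logarithms below are at
  least 1 there and the conversion to \<open>nat\<close> loses nothing.\<close>

definition adaptive_scan ::
  "fft_count \<Rightarrow> (nat list \<Rightarrow> real \<Rightarrow> real) \<Rightarrow> nat list list \<Rightarrow> nat \<Rightarrow> nat \<Rightarrow> nat \<Rightarrow> nat \<Rightarrow> real \<Rightarrow> array
     \<Rightarrow> real counted" where
  "adaptive_scan fft pval order d n hlo hhi \<epsilon> y = do {
     M \<leftarrow> init_dyad d n y;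
     M \<leftarrow> for_each order (aggregate n) M;
     alo \<leftarrow> spend 6 (nat \<lfloor>log 2 (\<epsilon>^2 * real hlo / (4 * real d))\<rfloor>);
     ahi \<leftarrow> spend 6 (nat \<lceil>log 2 (\<epsilon>^2 * real hhi / (4 * real d))\<rceil>);
     F \<leftarrow> spend 4 (nat \<lceil>8 * real d / \<epsilon>^2\<rceil>);
     for_each (product_lists (replicate d [alo..<Suc ahi])) (scan_level fft pval n F M) 1
   }"


section \<open>Inputs and bounds\<close>

definition scan_input ::
  "nat \<Rightarrow> nat \<Rightarrow> nat \<Rightarrow> nat \<Rightarrow> real \<Rightarrow> (nat list \<Rightarrow> real \<Rightarrow> real) \<Rightarrow> nat list list \<Rightarrow> bool" where
  "scan_input d L hlo hhi \<epsilon> pval order \<longleftrightarrow>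
     1 \<le> hlo \<and> hlo \<le> hhi \<and> hhi \<le> 2 ^ L \<and> 0 < \<epsilon> \<and> \<epsilon>^2 * real hlo \<ge> 8 * real d \<and>
     (\<forall>h s. 0 \<le> pval h s \<and> pval h s \<le> 1) \<and> valid_order d L order"

text \<open>The bounds on the transform start at \<open>n = 2\<close>: at \<open>n = 1\<close> a bound by a multiple of
  \<open>N log n\<close> would demand a convolution without any operation.\<close>

definition fft_upper :: "nat \<Rightarrow> real \<Rightarrow> fft_count \<Rightarrow> bool" where
  "fft_upper d K fft \<longleftrightarrow> (\<forall>L m f. L \<ge> 1 \<and> length m = d \<and> set m \<subseteq> {1..2 ^ L} \<and> length f = d \<longrightarrow>
     real (fft (2 ^ L) m f) \<le> K * real (prod_list m) * ln (2 ^ L))"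

definition fft_lower :: "nat \<Rightarrow> real \<Rightarrow> fft_count \<Rightarrow> bool" where
  "fft_lower d k fft \<longleftrightarrow> (\<forall>L m f. L \<ge> 1 \<and> length m = d \<and> set m \<subseteq> {1..2 ^ L} \<and> length f = d \<longrightarrow>
     k * real (prod_list m) * ln (2 ^ L) \<le> real (fft (2 ^ L) m f))"

text \<open>The constant of the upper bound by \<open>scan_order\<close> has to be uniform over \<open>\<epsilon>\<close> in bounded
  sets only.  It cannot be uniform over all \<open>\<epsilon> > 0\<close>: for \<open>d = 1\<close>, \<open>hlo = 1\<close> and
  \<open>\<epsilon>\<^sup>4 = ln n\<close> with \<open>n\<close> large there is a single shape \<open>f = 1\<close> per level, the finest grid
  scanned has at least \<open>2n/\<epsilon>\<^sup>2\<close> nodes, and transforms of cost \<open>N ln n\<close> take at least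
  \<open>2n (ln n)\<^bsup>1/2\<^esup>\<close> operations, while \<open>scan_order\<close> equals \<open>n\<close>.\<close>

definition scan_order :: "nat \<Rightarrow> nat \<Rightarrow> nat \<Rightarrow> real \<Rightarrow> real" where
  "scan_order d n hlo \<epsilon> =
     max (real n ^ d) (1 / \<epsilon> ^ (4 * d) * (real n / real hlo) ^ d * ln (real n))"

end

theory Submission
  imports Defs
begin

text \<open>No operation count depends on the data, so the total cost is an explicit sum.  The grid sizes
  \<open>\<Prod>\<^sub>j \<lfloor>n / 2\<^bsup>a\<^sub>j\<^esup>\<rfloor>\<close> factor over the coordinates; hence their sum over a cube of levels is the
  \<open>d\<close>-th power of a geometric sum, which is comparable to its largest term: \<open>n\<^sup>d\<close> for the dyadic
  sums and \<open>(n / 2\<^bsup>alo\<^esup>)\<^sup>d\<close>, of the order of \<open>(n / (\<epsilon>\<^sup>2 hlo))\<^sup>d\<close>, for the scan, where each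
  node is visited by of the order of \<open>\<epsilon>\<^bsup>-2d\<^esup>\<close> shapes.  For the lower bound the initialization
  and the finest level suffice; if \<open>\<epsilon>\<close> is so large that the finest level has an empty grid, then
  \<open>n\<^sup>d\<close> is the dominant term.\<close>

section \<open>Exact operation counts\<close>

lemma ops_bind [simp]: "ops (counted_bind c g) = ops c + ops (g (result c))"
  by (simp add: counted_bind_def)

lemma ops_spend [simp]: "ops (spend k x) = k"
  by (simp add: spend_def)

lemma result_spend [simp]: "result (spend k x) = x"
  by (simp add: spend_def)

text \<open>The count \<open>B i\<close> must be the same in every state \<open>s\<close>. This
  makes the cost of a loop a sum over its index list, although results do depend on the data. The
  summand \<open>length i\<close> pays for advancing the index.\<close>

lemma ops_for_each:
  assumes "\<And>i s. i \<in> set is \<Longrightarrow> ops (body i s) = B i"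
  shows "ops (for_each is body s) = (\<Sum>i\<leftarrow>is. length i + B i)"
  using assms by (induction "is" arbitrary: s) auto

lemma ops_for_each_const:
  assumes "\<And>i s. i \<in> set is \<Longrightarrow> ops (body i s) = c" "\<And>i. i \<in> set is \<Longrightarrow> length i = d"
  shows "ops (for_each is body s) = length is * (d + c)"
proof -
  have "ops (for_each is body s) = (\<Sum>i\<leftarrow>is. length i + c)"
    by (rule ops_for_each) (rule assms(1))
  also have "\<dots> = (\<Sum>i\<leftarrow>is. d + c)"
    using assms(2) by (metis (no_types, lifting) map_eq_conv)
  finally show ?thesis by (simp add: sum_list_triv)
qed

lemma length_product_lists: "length (product_lists xss) = prod_list (map length xss)"
  by (induction xss) (auto simp: length_concat o_def sum_list_triv)

lemma length_box [simp]: "length (box m) = prod_list m"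
  by (simp add: box_def length_product_lists o_def del: upt_Suc)

lemma length_in_box: "t \<in> set (box m) \<Longrightarrow> length t = length m"
  by (simp add: set_box)

lemma length_coarse_grid [simp]: "length (coarse_grid n a) = length a"
  by (simp add: coarse_grid_def)

lemma ops_init_dyad: "ops (init_dyad d n y) = n ^ d * (d + 2)"
  unfolding init_dyad_def
  by (subst ops_for_each_const[where c = 2 and d = d])
     (auto simp: write_cell_def dest: length_in_box)

lemma ops_aggregate:
  "ops (aggregate n a M) = 3 * length a + 1 + prod_list (coarse_grid n a) * (length a + 6)"
  unfolding aggregate_def
  by (simp, subst ops_for_each_const[where c = 6 and d = "length a"])
     (auto simp: write_cell_def read_cell_def dest: length_in_box)

text \<open>The first entry is read outside the loop; each further one costs \<open>d\<close> for
  the index and 2 for reading and comparing.\<close>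

lemma ops_max_over:
  assumes "\<And>t. t \<in> set ts \<Longrightarrow> length t = d"
  shows "ops (max_over ts g) = 1 + (length ts - 1) * (d + 2)"
proof -
  have "length t = d" if "t \<in> set (tl ts)" for t
    using assms that by (cases ts) auto
  then show ?thesis
    unfolding max_over_def by (simp add: ops_for_each_const[where c = 2 and d = d])
qed

text \<open>Two grids occur: the transform runs on the grid where the array is stored, the maximum
  only over \<open>coarse_grid\<close>. They differ at level \<open>ones d\<close>. The tail
  \<open>3 * length a + 4\<close> pays for the shape, its volume, the normalization, the P-value and
  the minimum.\<close>

definition shape_cost :: "fft_count \<Rightarrow> nat \<Rightarrow> nat list \<Rightarrow> nat list \<Rightarrow> nat" where
  "shape_cost fft n a f = fft n (dyad_grid n a) f
     + (1 + (prod_list (coarse_grid n a) - 1) * (length a + 2)) + 3 * length a + 4"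

lemma ops_scan_shape: "ops (scan_shape fft pval n M a f p) = shape_cost fft n a f"
  unfolding scan_shape_def fft_box_conv_def shape_cost_def
  by (simp add: ops_max_over[where d = "length a"] length_in_box)

definition level_cost :: "fft_count \<Rightarrow> nat \<Rightarrow> nat \<Rightarrow> nat list \<Rightarrow> nat" where
  "level_cost fft n F a = 3 * length a + (if 0 \<in> set (coarse_grid n a) then 0
     else \<Sum>f\<leftarrow>box (replicate (length a) F). length f + shape_cost fft n a f)"

lemma ops_scan_level: "ops (scan_level fft pval n F M a p) = level_cost fft n F a"
  unfolding scan_level_def level_cost_def
  by (auto intro!: ops_for_each ops_scan_shape)

abbreviation finest :: "nat \<Rightarrow> nat \<Rightarrow> real \<Rightarrow> nat" where
  "finest d hlo \<epsilon> \<equiv> nat \<lfloor>log 2 (\<epsilon>^2 * real hlo / (4 * real d))\<rfloor>"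

abbreviation coarsest :: "nat \<Rightarrow> nat \<Rightarrow> real \<Rightarrow> nat" where
  "coarsest d hhi \<epsilon> \<equiv> nat \<lceil>log 2 (\<epsilon>^2 * real hhi / (4 * real d))\<rceil>"

abbreviation shape_bound :: "nat \<Rightarrow> real \<Rightarrow> nat" where
  "shape_bound d \<epsilon> \<equiv> nat \<lceil>8 * real d / \<epsilon>^2\<rceil>"

text \<open>The 16 is 6 + 6 + 4, the price of the three rounded parameters.\<close>

lemma ops_adaptive_scan:
  "ops (adaptive_scan fft pval order d n hlo hhi \<epsilon> y) = n ^ d * (d + 2)
     + (\<Sum>a\<leftarrow>order. length a + (3 * length a + 1 + prod_list (coarse_grid n a) * (length a + 6)))
     + 16
     + (\<Sum>a\<leftarrow>product_lists (replicate d [finest d hlo \<epsilon>..<Suc (coarsest d hhi \<epsilon>)]).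
          length a + level_cost fft n (shape_bound d \<epsilon>) a)"
  unfolding adaptive_scan_def
  by (simp add: ops_init_dyad del: upt_Suc,
      subst ops_for_each[OF ops_aggregate], subst ops_for_each[OF ops_scan_level], simp del: upt_Suc)

section \<open>Sums over cubes of levels\<close>

text \<open>The distributive law: expanding the power yields one product per element of the cube. It
  turns sums of grid sizes into powers of one-dimensional sums.\<close>

lemma sum_list_product_lists:
  fixes g :: "'a \<Rightarrow> 'b::comm_semiring_1"
  shows "(\<Sum>a\<leftarrow>product_lists (replicate d xs). prod_list (map g a)) = (\<Sum>x\<leftarrow>xs. g x) ^ d"
proof (induction d)
  case (Suc d)
  \<comment> \<open>The tails \<open>yss\<close> are decoupled from the heads \<open>zs\<close>, so
    that the induction on \<open>zs\<close> leaves the smaller cube fixed.\<close>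
  have "(\<Sum>a\<leftarrow>concat (map (\<lambda>x. map ((#) x) yss) zs). prod_list (map g a))
      = (\<Sum>x\<leftarrow>zs. g x) * (\<Sum>a\<leftarrow>yss. prod_list (map g a))" for yss zs
    by (induction zs) (simp_all add: o_def sum_list_const_mult distrib_right)
  then show ?case using Suc by simp
qed simp

lemma in_set_product_listsD:
  "a \<in> set (product_lists (replicate d xs)) \<Longrightarrow> x \<in> set a \<Longrightarrow> x \<in> set xs"
  by (auto simp: product_lists_set list_all2_conv_all_nth in_set_conv_nth)

lemma sum_geometric_half:
  "(\<Sum>k\<leftarrow>[a..<b]. (2::real) ^ L / 2 ^ k) \<le> 2 * 2 ^ L / 2 ^ a"
proof (cases "a \<le> b")
  case True
  \<comment> \<open>The sum telescopes, since each term is twice itself minus twice its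
    successor.\<close>
  then have "(\<Sum>k\<leftarrow>[a..<b]. (2::real) ^ L / 2 ^ k) = 2 * 2 ^ L / 2 ^ a - 2 * 2 ^ L / 2 ^ b"
  proof (induction b rule: dec_induct)
    case (step b)
    then have "(\<Sum>k\<leftarrow>[a..<Suc b]. (2::real) ^ L / 2 ^ k)
        = 2 * 2 ^ L / 2 ^ a - 2 * 2 ^ L / 2 ^ b + 2 ^ L / 2 ^ b"
      by simp
    then show ?case by simp
  qed simp
  then show ?thesis by simp
qed simp

text \<open>In one coordinate the floors are dropped and the geometric sum is at most twice its
  first term; the \<open>d\<close>-th power of this is the bound on the cube.\<close>

lemma sum_coarse_grid_le:
  "real (\<Sum>a\<leftarrow>product_lists (replicate d [l..<u]). prod_list (coarse_grid (2 ^ L) a))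
     \<le> (2 * 2 ^ L / 2 ^ l) ^ d"
proof -
  have "real (\<Sum>k\<leftarrow>[l..<u]. 2 ^ L div 2 ^ k) = (\<Sum>k\<leftarrow>[l..<u]. real (2 ^ L div 2 ^ k))"
    by (simp add: o_def flip: sum_list_of_nat)
  also have "\<dots> \<le> (\<Sum>k\<leftarrow>[l..<u]. 2 ^ L / 2 ^ k)"
  proof (rule sum_list_mono)
    show "real (2 ^ L div 2 ^ k) \<le> 2 ^ L / 2 ^ k" for k
      using of_nat_div_le_of_nat[of "2 ^ L" "2 ^ k", where 'a = real] by simp
  qed
  also have "\<dots> \<le> 2 * 2 ^ L / 2 ^ l" by (rule sum_geometric_half)
  finally have "real (\<Sum>k\<leftarrow>[l..<u]. 2 ^ L div 2 ^ k) ^ d \<le> (2 * 2 ^ L / 2 ^ l) ^ d"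
    by (intro power_mono) simp_all
  then show ?thesis by (simp only: coarse_grid_def sum_list_product_lists of_nat_power)
qed

text \<open>Adding the missing level \<open>ones d\<close> only increases the sum, and the full cube
  is a product, so that its sum factors.\<close>

lemma sum_order_le:
  fixes g :: "nat list \<Rightarrow> nat"
  assumes "valid_order d L order"
  shows "(\<Sum>a\<leftarrow>order. g a) \<le> (\<Sum>a\<leftarrow>box (replicate d L). g a)"
proof -
  have "(\<Sum>a\<leftarrow>order. g a) = sum g (set order)"
    using assms by (simp add: valid_order_def sum_list_distinct_conv_sum_set)
  also have "\<dots> \<le> sum g (set (box (replicate d L)))"
    using assms by (intro sum_mono2) (auto simp: valid_order_def)
  also have "\<dots> = (\<Sum>a\<leftarrow>box (replicate d L). g a)"
    by (simp add: sum_list_distinct_conv_sum_set distinct_product_lists box_def del: upt_Suc)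
  finally show ?thesis .
qed

section \<open>The upper bound\<close>

lemma prod_list_coarse_grid_pos: "0 \<notin> set (coarse_grid n a) \<Longrightarrow> 1 \<le> prod_list (coarse_grid n a)"
  by (metis One_nat_def Suc_leI not_gr_zero prod_list_zero_iff)

text \<open>Only level \<open>ones d\<close> is stored on a larger grid, with side \<open>n\<close>
  in place of \<open>n / 2\<close>, whence the factor \<open>2 ^ d\<close>. A nonempty grid at
  positive levels forces \<open>L \<ge> 1\<close>, the range in which the transform bounds
  apply.\<close>

lemma dyad_grid_bounds:
  assumes "0 \<notin> set (coarse_grid (2 ^ L) a)" "\<forall>k\<in>set a. 1 \<le> k" "length a = d" "d \<ge> 1"
  shows "L \<ge> 1" "length (dyad_grid (2 ^ L) a) = d" "set (dyad_grid (2 ^ L) a) \<subseteq> {1..2 ^ L}"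
    "prod_list (coarse_grid (2 ^ L) a) \<le> prod_list (dyad_grid (2 ^ L) a)"
    "prod_list (dyad_grid (2 ^ L) a) \<le> 2 ^ d * prod_list (coarse_grid (2 ^ L) a)"
proof -
  obtain k where k: "k \<in> set a" using assms(3,4) by (cases a) auto
  have "2 ^ L div 2 ^ k \<noteq> (0::nat)"
    using assms(1) k by (auto simp: coarse_grid_def)
  then have "(2::nat) ^ k \<le> 2 ^ L" by (simp add: div_eq_0_iff)
  then have "k \<le> L" by simp
  then show L: "L \<ge> 1" using assms(2) k by force
  show "length (dyad_grid (2 ^ L) a) = d" using assms(3) by (simp add: dyad_grid_def)
  show "set (dyad_grid (2 ^ L) a) \<subseteq> {1..2 ^ L}"
    using assms(1) by (auto simp: dyad_grid_def coarse_grid_def Suc_le_eq intro: ccontr)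
  have *: "2 * (2 ^ L div 2) = (2 ^ L :: nat)"
    using L by (cases L) auto
  have ones: "prod_list (coarse_grid (2 ^ L) a) = (2 ^ L div 2) ^ d"
    "prod_list (dyad_grid (2 ^ L) a) = (2 * (2 ^ L div 2)) ^ d" if "a = ones d"
    using that by (simp_all only: *) (simp_all add: coarse_grid_def dyad_grid_def)
  show "prod_list (coarse_grid (2 ^ L) a) \<le> prod_list (dyad_grid (2 ^ L) a)"
    "prod_list (dyad_grid (2 ^ L) a) \<le> 2 ^ d * prod_list (coarse_grid (2 ^ L) a)"
    using ones assms(3)
    by (cases "a = ones d"; simp add: power_mult_distrib dyad_grid_def)+
qed

text \<open>An empty grid costs only the test. Otherwise \<open>n \<ge> 2\<close>, so the operations
  outside the transform, linear in the number \<open>N\<close> of nodes, are absorbed into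
  \<open>N * ln n\<close> after division by \<open>ln 2\<close>.\<close>

lemma level_cost_le:
  assumes "fft_upper d K fft" "\<forall>k\<in>set a. 1 \<le> k" "length a = d" "d \<ge> 1" "K > 0"
  shows "real (level_cost fft (2 ^ L) F a) \<le> 3 * d + real F ^ d *
    ((K * 2 ^ d + (5 * real d + 7) / ln 2) * real (prod_list (coarse_grid (2 ^ L) a)) * ln (2 ^ L))"
proof (cases "0 \<in> set (coarse_grid (2 ^ L) a)")
  case True
  then have "prod_list (coarse_grid (2 ^ L) a) = 0" by (simp add: prod_list_zero_iff)
  with True show ?thesis using assms(3) by (simp add: level_cost_def)
next
  case False
  define N where "N = prod_list (coarse_grid (2 ^ L) a)"
  define c where "c = (K * 2 ^ d + (5 * real d + 7) / ln 2) * real N * ln (2 ^ L)"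
  note g = dyad_grid_bounds[OF False assms(2-4)]
  have N: "N \<ge> 1" unfolding N_def by (rule prod_list_coarse_grid_pos[OF False])
  have ln2: "ln 2 \<le> ln ((2::real) ^ L)" using g(1) by (subst ln_le_cancel_iff) (auto simp: self_le_power)
  have c: "real (length f + shape_cost fft (2 ^ L) a f) \<le> c" if "length f = d" for f
  proof -
    have "real (fft (2 ^ L) (dyad_grid (2 ^ L) a) f)
        \<le> K * real (prod_list (dyad_grid (2 ^ L) a)) * ln (2 ^ L)"
      using assms(1) g(1-3) that unfolding fft_upper_def by blast
    also have "\<dots> \<le> K * real (2 ^ d * N) * ln (2 ^ L)"
      using g(5) assms(5) unfolding N_def
      by (intro mult_right_mono mult_left_mono of_nat_mono) (auto intro: ln_ge_zero)
    finally have 1: "real (fft (2 ^ L) (dyad_grid (2 ^ L) a) f) \<le> K * 2 ^ d * N * ln (2 ^ L)"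
      by simp
    obtain N' where N': "N = Suc N'" using N by (cases N) auto
    \<comment> \<open>The fixed part is \<open>4 * d + 5\<close> and every node after the first adds
      \<open>d + 2\<close>; the two sum to \<open>5 * d + 7\<close>.\<close>
    have "real (d + (1 + (N - 1) * (d + 2)) + 3 * d + 4) \<le> real ((5 * d + 7) * N)"
      unfolding N' of_nat_le_iff by (simp add: algebra_simps)
    also have "\<dots> = (5 * d + 7) * N / ln 2 * ln 2" by simp
    also have "\<dots> \<le> (5 * d + 7) * N / ln 2 * ln (2 ^ L)"
      using ln2 by (intro mult_left_mono) auto
    finally have 2: "real (d + (1 + (N - 1) * (d + 2)) + 3 * d + 4)
      \<le> (5 * d + 7) * N / ln 2 * ln (2 ^ L)" .
    show ?thesis using 1 2 that assms(3)
      by (simp add: shape_cost_def c_def algebra_simps add_divide_distrib flip: N_def)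
  qed
  have "real (level_cost fft (2 ^ L) F a)
      = 3 * d + (\<Sum>f\<leftarrow>box (replicate d F). real (length f + shape_cost fft (2 ^ L) a f))"
    using False assms(3) by (simp add: level_cost_def o_def flip: sum_list_of_nat)
  also have "\<dots> \<le> 3 * d + (\<Sum>f\<leftarrow>box (replicate d F). c)"
    by (intro add_left_mono sum_list_mono c) (simp add: length_in_box)
  finally show ?thesis by (simp add: sum_list_triv c_def N_def)
qed

section \<open>Rounding of the extreme levels and of the range of shapes\<close>

text \<open>The argument of the logarithm is at least 2, so the floor is positive, and rounding down
  loses less than a factor 2.\<close>

lemma finest_bounds:
  assumes "\<epsilon>^2 * real hlo \<ge> 8 * real d" "d \<ge> 1"
  shows "1 \<le> finest d hlo \<epsilon>" "2 ^ finest d hlo \<epsilon> \<le> \<epsilon>^2 * real hlo / (4 * real d)"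
    "\<epsilon>^2 * real hlo / (8 * real d) \<le> 2 ^ finest d hlo \<epsilon>"
proof -
  define x where "x = \<epsilon>^2 * real hlo / (4 * real d)"
  have x: "2 \<le> x" using assms by (simp add: x_def field_simps)
  have l: "1 \<le> log 2 x" using x by (simp add: le_log_iff)
  define m where "m = nat \<lfloor>log 2 x\<rfloor>"
  have f: "real m \<le> log 2 x" "log 2 x < real m + 1" and m: "1 \<le> m"
    unfolding m_def using l by linarith+
  have "2 powr real m \<le> x" using f(1) x by (subst (asm) le_log_iff) auto
  then have 1: "2 ^ m \<le> x" by (simp add: powr_realpow)
  have "x < 2 powr (real m + 1)" using f(2) x by (subst (asm) log_less_iff) auto
  then have "x / 2 \<le> 2 ^ m" by (simp add: powr_add powr_realpow)
  with 1 m show "1 \<le> finest d hlo \<epsilon>" "2 ^ finest d hlo \<epsilon> \<le> \<epsilon>^2 * real hlo / (4 * real d)"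
    "\<epsilon>^2 * real hlo / (8 * real d) \<le> 2 ^ finest d hlo \<epsilon>"
    unfolding m_def x_def by simp_all
qed

text \<open>A linear bound in \<open>L\<close> is weakened by \<open>L < 2 ^ L\<close> to a multiple
  of \<open>n\<close>, since the number of levels only has to be \<open>O(n ^ d)\<close>. The
  absolute value is there because the logarithm of the \<open>E\<close>-term may be
  negative.\<close>

lemma coarsest_le:
  assumes "\<epsilon>^2 * real hhi \<ge> 8 * real d" "d \<ge> 1" "hhi \<le> 2 ^ L" "0 < \<epsilon>" "\<epsilon> \<le> E"
  shows "real (coarsest d hhi \<epsilon>) \<le> (2 + \<bar>log 2 (E^2 / (4 * real d))\<bar>) * 2 ^ L"
proof -
  define x where "x = \<epsilon>^2 * real hhi / (4 * real d)"
  define z where "z = log 2 (E^2 / (4 * real d))"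
  have x: "2 \<le> x" using assms by (simp add: x_def field_simps)
  have "1 \<le> log 2 x" using x by (simp add: le_log_iff)
  then have "real (nat \<lceil>log 2 x\<rceil>) \<le> log 2 x + 1" by linarith
  also have "log 2 x \<le> log 2 (E^2 / (4 * real d) * 2 ^ L)"
  proof -
    have "\<epsilon>^2 * real hhi \<le> E^2 * 2 ^ L"
      using assms by (intro mult_mono power_mono) (auto simp: numeral_power_le_of_nat_cancel_iff)
    then show ?thesis
      using x by (intro log_mono) (auto simp: x_def divide_right_mono)
  qed
  also have "\<dots> = z + L"
    using assms unfolding z_def by (subst log_mult) (auto simp: log_nat_power)
  also have "\<dots> + 1 \<le> (1 + \<bar>z\<bar>) * 1 + 2 ^ L"
    using add_mono[OF abs_ge_self[of z] less_imp_le[OF of_nat_less_two_power[of L]]] by simp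
  also have "\<dots> \<le> (1 + \<bar>z\<bar>) * 2 ^ L + 2 ^ L"
    by (intro add_right_mono mult_left_mono) auto
  finally show ?thesis by (simp add: x_def z_def algebra_simps)
qed

text \<open>Rounding up adds at most 1, which \<open>E^2 / \<epsilon>^2\<close> dominates when
  \<open>\<epsilon> \<le> E\<close>. This keeps the number of shapes per axis of order
  \<open>1 / \<epsilon>^2\<close>.\<close>

lemma shape_bound_bounds:
  assumes "0 < \<epsilon>"
  shows "8 * real d / \<epsilon>^2 \<le> shape_bound d \<epsilon>"
    "\<epsilon> \<le> E \<Longrightarrow> shape_bound d \<epsilon> \<le> (8 * real d + E^2) / \<epsilon>^2"
proof -
  show "8 * real d / \<epsilon>^2 \<le> shape_bound d \<epsilon>" by linarith
  assume "\<epsilon> \<le> E"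
  then have "1 \<le> E^2 / \<epsilon>^2" using assms by (simp add: power_mono)
  moreover have "0 \<le> 8 * real d / \<epsilon>^2" by simp
  then have "real (shape_bound d \<epsilon>) \<le> 8 * real d / \<epsilon>^2 + 1" by linarith
  ultimately show "shape_bound d \<epsilon> \<le> (8 * real d + E^2) / \<epsilon>^2"
    unfolding add_divide_distrib by linarith
qed

section \<open>Summation over all levels\<close>

text \<open>The first term counts levels: each costs at most \<open>4 * d\<close> for its index and
  the emptiness test, even if its grid is empty. The second is the geometric sum of grid sizes times
  the number of shapes.\<close>

lemma scan_cost_le:
  assumes "fft_upper d K fft" "d \<ge> 1" "K > 0" and l: "1 \<le> l"
    and u: "real u \<le> B * 2 ^ L"
  shows "real (\<Sum>a\<leftarrow>product_lists (replicate d [l..<Suc u]). length a + level_cost fft (2 ^ L) F a)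
    \<le> 4 * real d * (B * 2 ^ L) ^ d
      + (K * 2 ^ d + (5 * real d + 7) / ln 2) * (real F * (2 * 2 ^ L / 2 ^ l)) ^ d * ln (2 ^ L)"
proof -
  let ?as = "product_lists (replicate d [l..<Suc u])"
  define c where "c = K * 2 ^ d + (5 * real d + 7) / ln 2"
  have c: "0 \<le> c" unfolding c_def using assms(3) by simp
  have "real (\<Sum>a\<leftarrow>?as. length a + level_cost fft (2 ^ L) F a)
      = (\<Sum>a\<leftarrow>?as. real (length a + level_cost fft (2 ^ L) F a))"
    by (simp add: o_def flip: sum_list_of_nat del: upt_Suc)
  also have "\<dots> \<le> (\<Sum>a\<leftarrow>?as. 4 * real d
      + real F ^ d * c * ln (2 ^ L) * real (prod_list (coarse_grid (2 ^ L) a)))"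
  proof (rule sum_list_mono)
    fix a assume a: "a \<in> set ?as"
    have len: "length a = d" using in_set_product_lists_length[OF a] by simp
    have "\<forall>k\<in>set a. 1 \<le> k" using in_set_product_listsD[OF a] l by fastforce
    from level_cost_le[OF assms(1) this len assms(2,3), of L F] len
    show "real (length a + level_cost fft (2 ^ L) F a) \<le> 4 * real d
      + real F ^ d * c * ln (2 ^ L) * real (prod_list (coarse_grid (2 ^ L) a))"
      by (simp add: c_def mult_ac)
  qed
  also have "\<dots> = 4 * real d * real (Suc u - l) ^ d
      + real F ^ d * c * ln (2 ^ L) * real (\<Sum>a\<leftarrow>?as. prod_list (coarse_grid (2 ^ L) a))"
    by (simp add: sum_list_addf sum_list_const_mult sum_list_triv length_product_lists o_def
        del: upt_Suc flip: sum_list_of_nat)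
  also have "\<dots> \<le> 4 * real d * (B * 2 ^ L) ^ d + real F ^ d * c * ln (2 ^ L) * (2 * 2 ^ L / 2 ^ l) ^ d"
  proof (intro add_mono mult_left_mono power_mono sum_coarse_grid_le)
    \<comment> \<open>As \<open>l \<ge> 1\<close>, there are at most \<open>u\<close> values per
      coordinate.\<close>
    show "real (Suc u - l) \<le> B * 2 ^ L" using u l by linarith
  qed (use c in \<open>auto intro!: mult_nonneg_nonneg ln_ge_zero\<close>)
  finally show ?thesis by (simp only: c_def power_mult_distrib mult_ac)
qed

text \<open>The number of levels is at most \<open>L ^ d\<close>, hence at most
  \<open>n ^ d\<close>. The grid sizes from level 1 on also sum to at most \<open>n ^ d\<close>, as
  the factor 2 of the geometric sum cancels the first halving.\<close>

lemma aggregation_cost_le: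
  assumes "valid_order d L order"
  shows "real (\<Sum>a\<leftarrow>order. length a + (3 * length a + 1
      + prod_list (coarse_grid (2 ^ L) a) * (length a + 6))) \<le> real (5 * d + 7) * (2 ^ L) ^ d"
proof -
  let ?as = "box (replicate d L)"
  have as: "?as = product_lists (replicate d [1..<Suc L])" by (simp add: box_def del: upt_Suc)
  have "(\<Sum>a\<leftarrow>order. length a + (3 * length a + 1 + prod_list (coarse_grid (2 ^ L) a) * (length a + 6)))
      \<le> (\<Sum>a\<leftarrow>?as. length a + (3 * length a + 1 + prod_list (coarse_grid (2 ^ L) a) * (length a + 6)))"
    by (rule sum_order_le[OF assms])
  also have "\<dots> = (\<Sum>a\<leftarrow>?as. (4 * d + 1) + prod_list (coarse_grid (2 ^ L) a) * (d + 6))"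
    by (intro arg_cong[where f = sum_list] map_cong) (auto dest: length_in_box)
  also have "\<dots> = L ^ d * (4 * d + 1) + (\<Sum>a\<leftarrow>?as. prod_list (coarse_grid (2 ^ L) a)) * (d + 6)"
    by (simp only: sum_list_addf sum_list_mult_const sum_list_triv length_box) (simp add: distrib_left)
  finally have "real (\<Sum>a\<leftarrow>order. length a + (3 * length a + 1
      + prod_list (coarse_grid (2 ^ L) a) * (length a + 6)))
     \<le> real (L ^ d * (4 * d + 1) + (\<Sum>a\<leftarrow>?as. prod_list (coarse_grid (2 ^ L) a)) * (d + 6))"
    by (rule of_nat_mono)
  also have "\<dots> = real L ^ d * (4 * d + 1)
      + real (\<Sum>a\<leftarrow>?as. prod_list (coarse_grid (2 ^ L) a)) * (d + 6)"
    by (simp only: of_nat_add of_nat_mult of_nat_power)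
  also have "\<dots> \<le> (2 ^ L) ^ d * real (4 * d + 1) + (2 ^ L) ^ d * real (d + 6)"
    using sum_coarse_grid_le[where d = d and l = 1 and u = "Suc L" and L = L, folded as]
    by (intro add_mono mult_right_mono power_mono) (auto intro: less_imp_le of_nat_less_two_power)
  finally show ?thesis by (simp add: algebra_simps)
qed

lemma adaptive_scan_upper:
  assumes "d \<ge> 1" "K > 0" "fft_upper d K fft" "E > 0"
  shows "\<exists>C>0. \<forall>L n hlo hhi \<epsilon> pval order y.
    n = 2 ^ L \<and> scan_input d L hlo hhi \<epsilon> pval order \<and> \<epsilon> \<le> E \<longrightarrow>
    real (ops (adaptive_scan fft pval order d n hlo hhi \<epsilon> y)) \<le> C * scan_order d n hlo \<epsilon>"
proof -
  define B where "B = 2 + \<bar>log 2 (E^2 / (4 * real d))\<bar>"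
  define c where "c = K * 2 ^ d + (5 * real d + 7) / ln 2"
  \<comment> \<open>Initialization, aggregation and parameters give
    \<open>(d + 2) + (5 * d + 7) + 16\<close>; the rest counts levels.\<close>
  define C\<^sub>1 where "C\<^sub>1 = 6 * real d + 25 + 4 * real d * B ^ d"
  \<comment> \<open>The first factor in the power comes from the number of shapes per axis;
    \<open>16 * d\<close> is the geometric factor 2 times the \<open>8 * d\<close> of the finest
    level.\<close>
  define C\<^sub>2 where "C\<^sub>2 = c * ((8 * real d + E^2) * (16 * d)) ^ d"
  have c: "c > 0" unfolding c_def using assms by (intro add_pos_nonneg) auto
  have B: "B > 0" unfolding B_def by simp
  have C: "C\<^sub>1 > 0" "C\<^sub>2 > 0" unfolding C\<^sub>1_def C\<^sub>2_def using c assms B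
    by (auto intro!: mult_pos_pos zero_less_power add_pos_nonneg)
  show ?thesis
  proof (intro exI[of _ "C\<^sub>1 + C\<^sub>2"] conjI allI impI)
    fix L n hlo hhi :: nat and \<epsilon> pval order and y :: array
    assume "n = 2 ^ L \<and> scan_input d L hlo hhi \<epsilon> pval order \<and> \<epsilon> \<le> E"
    then have n: "n = 2 ^ L" and hlo: "1 \<le> hlo" "hlo \<le> hhi" "hhi \<le> 2 ^ L" and eps: "0 < \<epsilon>" "\<epsilon> \<le> E"
      and big: "8 * real d \<le> \<epsilon>^2 * real hlo" and ord: "valid_order d L order"
      by (auto simp: scan_input_def)
    let ?l = "finest d hlo \<epsilon>" and ?F = "shape_bound d \<epsilon>"
    have "\<epsilon>^2 * real hlo \<le> \<epsilon>^2 * real hhi" using hlo by (intro mult_left_mono) auto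
    with big have "8 * real d \<le> \<epsilon>^2 * real hhi" by linarith
    note u = coarsest_le[OF this assms(1) hlo(3) eps, folded B_def]
    note l = finest_bounds[OF big assms(1)]
    \<comment> \<open>Shapes and nodes per axis contribute one factor
      \<open>1 / \<epsilon>^2\<close> each, hence \<open>\<epsilon> ^ (4 * d)\<close>.\<close>
    have T: "(real ?F * (2 * 2 ^ L / 2 ^ ?l)) ^ d
      \<le> ((8 * real d + E^2) * (16 * d)) ^ d * (1 / \<epsilon> ^ (4 * d) * (real n / hlo) ^ d)"
    proof -
      have "2 * 2 ^ L / 2 ^ ?l \<le> 2 * 2 ^ L / (\<epsilon>^2 * real hlo / (8 * real d))"
        using l(3) hlo eps assms(1) by (intro divide_left_mono) auto
      then have "real ?F * (2 * 2 ^ L / 2 ^ ?l)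
          \<le> (8 * real d + E^2) / \<epsilon>^2 * (2 * 2 ^ L / (\<epsilon>^2 * real hlo / (8 * real d)))"
        using shape_bound_bounds(2)[OF eps] by (intro mult_mono) auto
      also have "\<dots> = (8 * real d + E^2) * (16 * d) * (1 / \<epsilon> ^ 4 * (real n / hlo))"
        by (simp add: n field_simps eval_nat_numeral)
      finally have "(real ?F * (2 * 2 ^ L / 2 ^ ?l)) ^ d
          \<le> ((8 * real d + E^2) * (16 * d) * (1 / \<epsilon> ^ 4 * (real n / hlo))) ^ d"
        by (intro power_mono mult_nonneg_nonneg of_nat_0_le_iff) simp_all
      then show ?thesis by (simp only: power_mult_distrib power_divide power_mult power_one)
    qed
    have total: "real ((2 ^ L) ^ d * (d + 2) + A + 16 + S)
        \<le> (2 ^ L) ^ d * real (d + 2) + A' + 16 * (2 ^ L) ^ d + S'"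
      if "real A \<le> A'" "real S \<le> S'" for A S A' S'
    proof -
      have "(1::real) \<le> (2 ^ L) ^ d" by simp
      then show ?thesis
        using that unfolding of_nat_add of_nat_mult of_nat_power of_nat_numeral by linarith
    qed
    have "real (ops (adaptive_scan fft pval order d n hlo hhi \<epsilon> y))
        \<le> (2 ^ L) ^ d * real (d + 2) + real (5 * d + 7) * (2 ^ L) ^ d + 16 * (2 ^ L) ^ d
          + (4 * real d * (B * 2 ^ L) ^ d + c * (real ?F * (2 * 2 ^ L / 2 ^ ?l)) ^ d * ln (2 ^ L))"
      unfolding n ops_adaptive_scan
      by (rule total[OF aggregation_cost_le[OF ord]
            scan_cost_le[OF assms(3,1,2) l(1) u, of ?F, folded c_def]])
    also have "\<dots> = C\<^sub>1 * real n ^ d + c * (real ?F * (2 * 2 ^ L / 2 ^ ?l)) ^ d * ln n"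
      by (simp add: C\<^sub>1_def n algebra_simps power_mult_distrib)
    also have "\<dots> \<le> C\<^sub>1 * real n ^ d
        + C\<^sub>2 * (1 / \<epsilon> ^ (4 * d) * (real n / hlo) ^ d * ln n)"
    proof -
      have "c * (real ?F * (2 * 2 ^ L / 2 ^ ?l)) ^ d * ln n \<le>
        c * (((8 * real d + E^2) * (16 * d)) ^ d * (1 / \<epsilon> ^ (4 * d) * (real n / hlo) ^ d)) * ln n"
        using c T by (intro mult_right_mono mult_left_mono) (auto simp: n intro: ln_ge_zero)
      then show ?thesis by (simp add: C\<^sub>2_def mult_ac)
    qed
    also have "\<dots> \<le> C\<^sub>1 * scan_order d n hlo \<epsilon> + C\<^sub>2 * scan_order d n hlo \<epsilon>"
      unfolding scan_order_def using C by (intro add_mono mult_left_mono) auto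
    finally show "real (ops (adaptive_scan fft pval order d n hlo hhi \<epsilon> y))
        \<le> (C\<^sub>1 + C\<^sub>2) * scan_order d n hlo \<epsilon>" by (simp add: algebra_simps)
  qed (use C in simp)
qed

section \<open>The lower bound\<close>

text \<open>The transforms alone suffice, one for each of the \<open>F ^ d\<close> shapes.\<close>

lemma level_cost_ge:
  assumes "fft_lower d k fft" "k > 0" "length a = d" "d \<ge> 1" "\<forall>b\<in>set a. 1 \<le> b"
    "0 \<notin> set (coarse_grid (2 ^ L) a)"
  shows "k * real F ^ d * real (prod_list (coarse_grid (2 ^ L) a)) * ln (2 ^ L)
    \<le> real (level_cost fft (2 ^ L) F a)"
proof -
  note g = dyad_grid_bounds[OF assms(6,5,3,4)]
  define c where "c = k * real (prod_list (coarse_grid (2 ^ L) a)) * ln (2 ^ L)"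
  have c: "c \<le> real (length f + shape_cost fft (2 ^ L) a f)" if "length f = d" for f
  proof -
    have "c \<le> k * real (prod_list (dyad_grid (2 ^ L) a)) * ln (2 ^ L)"
      unfolding c_def using g(4) assms(2)
      by (intro mult_right_mono mult_left_mono of_nat_mono) (auto intro: ln_ge_zero)
    also have "\<dots> \<le> real (fft (2 ^ L) (dyad_grid (2 ^ L) a) f)"
      using assms(1) g(1-3) that unfolding fft_lower_def by blast
    also have "\<dots> \<le> real (length f + shape_cost fft (2 ^ L) a f)"
      unfolding shape_cost_def by (intro of_nat_mono) simp
    finally show ?thesis .
  qed
  have "(\<Sum>f\<leftarrow>box (replicate d F). c)
      \<le> (\<Sum>f\<leftarrow>box (replicate d F). real (length f + shape_cost fft (2 ^ L) a f))"
    by (intro sum_list_mono c) (simp add: length_in_box)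
  also have "\<dots> \<le> real (level_cost fft (2 ^ L) F a)"
    using assms(3,6) by (simp add: level_cost_def o_def flip: sum_list_of_nat)
  finally show ?thesis by (simp add: sum_list_triv c_def mult_ac)
qed

text \<open>This serves the case of an empty finest grid. The first hypothesis gives
  \<open>\<epsilon>^2 * hlo \<ge> n\<close>, and \<open>hlo \<le> n\<close> then gives
  \<open>\<epsilon> \<ge> 1\<close>. So the second term of the maximum is at most
  \<open>ln n\<close>.\<close>

lemma scan_order_le_power:
  assumes "8 * real d * real n \<le> \<epsilon>^2 * real hlo" "d \<ge> 1" "n \<ge> 1" "1 \<le> hlo" "hlo \<le> n" "0 < \<epsilon>"
  shows "scan_order d n hlo \<epsilon> \<le> real n ^ d"
proof -
  have n: "1 \<le> real n" "1 \<le> real hlo" "real hlo \<le> real n" using assms(3-5) by auto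
  have "real n \<le> 8 * real d * real n" using assms(2) n by simp
  then have *: "real n \<le> \<epsilon>^2 * real hlo" using assms(1) by linarith
  also have "\<dots> \<le> \<epsilon>^2 * real n" using n by (intro mult_left_mono) auto
  finally have "1 \<le> \<epsilon>^2" using n by simp
  then have "real n * 1 \<le> (\<epsilon>^2 * real hlo) * \<epsilon>^2"
    using * by (intro mult_mono) auto
  then have "1 / \<epsilon> ^ 4 * (real n / real hlo) \<le> 1"
    using n assms(6) by (simp add: field_simps eval_nat_numeral)
  then have "(1 / \<epsilon> ^ 4 * (real n / real hlo)) ^ d \<le> 1"
    using assms(6) by (intro power_le_one) auto
  then have "1 / \<epsilon> ^ (4 * d) * (real n / real hlo) ^ d \<le> 1"
    by (simp only: power_mult_distrib power_divide power_mult power_one)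
  then have "1 / \<epsilon> ^ (4 * d) * (real n / real hlo) ^ d * ln n \<le> 1 * ln n"
    using n by (intro mult_right_mono) auto
  also have "\<dots> \<le> real n ^ 1" using ln_bound[of "real n"] n by simp
  also have "\<dots> \<le> real n ^ d" using n assms(2) by (intro power_increasing) auto
  finally show ?thesis by (simp add: scan_order_def)
qed

lemma adaptive_scan_lower:
  assumes "d \<ge> 1" "k > 0" "fft_lower d k fft"
  shows "\<exists>c>0. \<forall>L n hlo hhi \<epsilon> pval order y.
    n = 2 ^ L \<and> scan_input d L hlo hhi \<epsilon> pval order \<longrightarrow>
    c * scan_order d n hlo \<epsilon> \<le> real (ops (adaptive_scan fft pval order d n hlo hhi \<epsilon> y))"
proof -
  \<comment> \<open>The number of shapes per axis is at least \<open>8 * d / \<epsilon>^2\<close>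
    and the finest grid has side at least \<open>4 * d * n / (\<epsilon>^2 * hlo)\<close>;
    \<open>32 * d ^ 2\<close> is the product of the constants. The cap 1 is for the comparison with
    the initialization.\<close>
  define c where "c = min 1 (k * (32 * real d ^ 2) ^ d)"
  have c: "c > 0" "c \<le> 1" "c \<le> k * (32 * real d ^ 2) ^ d" unfolding c_def using assms by auto
  show ?thesis
  proof (intro exI[of _ c] conjI allI impI)
    fix L n hlo hhi :: nat and \<epsilon> pval order and y :: array
    assume "n = 2 ^ L \<and> scan_input d L hlo hhi \<epsilon> pval order"
    then have n: "n = 2 ^ L" and hlo: "1 \<le> hlo" "hlo \<le> hhi" "hhi \<le> 2 ^ L" and eps: "0 < \<epsilon>"
      and big: "8 * real d \<le> \<epsilon>^2 * real hlo" and ord: "valid_order d L order"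
      by (auto simp: scan_input_def)
    let ?l = "finest d hlo \<epsilon>" and ?u = "coarsest d hhi \<epsilon>" and ?F = "shape_bound d \<epsilon>"
    let ?cost = "real (ops (adaptive_scan fft pval order d n hlo hhi \<epsilon> y))"
    let ?T = "1 / \<epsilon> ^ (4 * d) * (real n / real hlo) ^ d * ln (real n)"
    note l = finest_bounds[OF big assms(1)]
    have "n ^ d \<le> ops (adaptive_scan fft pval order d n hlo hhi \<epsilon> y)"
      unfolding ops_adaptive_scan by (simp del: upt_Suc)
    then have init: "real n ^ d \<le> ?cost" by (metis of_nat_le_iff of_nat_power)
    have c_le: "c * z \<le> z" if "0 \<le> z" for z :: real
      using c(2) that mult_right_mono by fastforce
    show "c * scan_order d n hlo \<epsilon> \<le> ?cost"
    proof (cases "?l \<le> L")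
      case False
      then have "(2::real) ^ (L + 1) \<le> 2 ^ ?l" by (intro power_increasing) auto
      then have "2 * real n \<le> \<epsilon>^2 * real hlo / (4 * real d)" using l(2) by (simp add: n)
      then have "8 * real d * real n \<le> \<epsilon>^2 * real hlo" using assms(1) by (simp add: field_simps)
      then have "scan_order d n hlo \<epsilon> \<le> real n ^ d"
        using assms(1) n hlo eps by (intro scan_order_le_power) auto
      then have "c * scan_order d n hlo \<epsilon> \<le> c * real n ^ d" using c by simp
      also have "\<dots> \<le> real n ^ d" by (intro c_le) simp
      finally show ?thesis using init by linarith
    next
      case True
      \<comment> \<open>The corner of the cube of levels with the largest grid; its cost alone
        reaches the second term of the maximum.\<close>
      let ?a = "replicate d ?l"
      have "?l \<le> ?u"
      proof -
        have "log 2 (\<epsilon>^2 * real hlo / (4 * real d)) \<le> log 2 (\<epsilon>^2 * real hhi / (4 * real d))"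
          using assms(1) hlo eps by (intro log_mono divide_right_mono mult_left_mono) auto
        then show ?thesis by linarith
      qed
      then have a: "?a \<in> set (product_lists (replicate d [?l..<Suc ?u]))"
        by (auto simp: product_lists_set list_all2_conv_all_nth simp del: upt_Suc)
      \<comment> \<open>The division is exact here, so the lower bound on the side loses nothing to
        the floor.\<close>
      have div: "(2::nat) ^ L div 2 ^ ?l = 2 ^ (L - ?l)" using True by (simp add: power_diff)
      have "4 * real d * real n / (\<epsilon>^2 * real hlo) = 2 ^ L / (\<epsilon>^2 * real hlo / (4 * real d))"
        by (simp add: n)
      also have "\<dots> \<le> 2 ^ L / 2 ^ ?l" using l(2) hlo eps assms(1)
        by (intro divide_left_mono mult_pos_pos divide_pos_pos) auto
      also have "\<dots> = real (2 ^ L div 2 ^ ?l)" using True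
        by (simp add: div power_diff[of "2::real"])
      finally have N: "4 * real d * real n / (\<epsilon>^2 * real hlo) \<le> real (2 ^ L div 2 ^ ?l)" .
      have "c * ?T \<le> k * (32 * real d ^ 2) ^ d * ?T"
        using c eps n by (intro mult_right_mono mult_nonneg_nonneg) (auto intro: ln_ge_zero)
      also have "\<dots> = k * (32 * real d ^ 2 * (1 / \<epsilon> ^ 4 * (real n / hlo))) ^ d * ln n"
        by (simp only: power_mult_distrib power_divide power_mult power_one mult.assoc)
      also have "32 * real d ^ 2 * (1 / \<epsilon> ^ 4 * (real n / hlo))
          = 8 * real d / \<epsilon>^2 * (4 * real d * real n / (\<epsilon>^2 * real hlo))"
        by (simp add: field_simps eval_nat_numeral)
      also have "k * \<dots> ^ d * ln n \<le> k * (real ?F * real (2 ^ L div 2 ^ ?l)) ^ d * ln n"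
        using N shape_bound_bounds(1)[OF eps, of d] assms(2)
        by (intro mult_right_mono mult_left_mono power_mono mult_mono of_nat_0_le_iff)
          (auto simp: n intro: ln_ge_zero)
      also have "\<dots> = k * real ?F ^ d * real (prod_list (coarse_grid (2 ^ L) ?a)) * ln (2 ^ L)"
        by (simp add: coarse_grid_def n power_mult_distrib)
      also have "\<dots> \<le> real (level_cost fft (2 ^ L) ?F ?a)"
        using assms l(1) by (intro level_cost_ge) (auto simp: coarse_grid_def div)
      also have "\<dots> \<le> ?cost"
      proof (rule of_nat_mono)
        have "level_cost fft (2 ^ L) ?F ?a \<le> length ?a + level_cost fft (2 ^ L) ?F ?a" by simp
        also have "\<dots> \<le> (\<Sum>a\<leftarrow>product_lists (replicate d [?l..<Suc ?u]).
            length a + level_cost fft (2 ^ L) ?F a)"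
          by (rule member_le_sum_list) (use a in \<open>auto simp del: upt_Suc length_replicate\<close>)
        finally show "level_cost fft (2 ^ L) ?F ?a \<le> ops (adaptive_scan fft pval order d n hlo hhi \<epsilon> y)"
          unfolding ops_adaptive_scan n by linarith
      qed
      finally have "c * ?T \<le> ?cost" .
      moreover have "c * real n ^ d \<le> ?cost" by (rule order_trans[OF c_le init]) simp
      ultimately show ?thesis unfolding scan_order_def by (simp add: max_def)
    qed
  qed (use c in simp)
qed

text \<open>The lower half is conditional on \<open>fft_lower\<close> because
  \<open>fft_upper\<close> also admits transforms of cost 0, for which the factor
  \<open>ln n\<close> would not be attained.\<close>

theorem proposition10:
  fixes d :: nat and E K :: real and fft :: fft_count
  assumes "d \<ge> 1" and "E > 0" and "K > 0" and "fft_upper d K fft"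
  shows "(\<exists>C>0. \<forall>L n hlo hhi \<epsilon> pval order y.
            n = 2 ^ L \<and> scan_input d L hlo hhi \<epsilon> pval order \<and> \<epsilon> \<le> E \<longrightarrow>
            real (ops (adaptive_scan fft pval order d n hlo hhi \<epsilon> y)) \<le> C * scan_order d n hlo \<epsilon>)
       \<and> ((\<exists>k>0. fft_lower d k fft) \<longrightarrow>
          (\<exists>c>0. \<forall>L n hlo hhi \<epsilon> pval order y.
            n = 2 ^ L \<and> scan_input d L hlo hhi \<epsilon> pval order \<longrightarrow>
            c * scan_order d n hlo \<epsilon> \<le> real (ops (adaptive_scan fft pval order d n hlo hhi \<epsilon> y))))"
  using adaptive_scan_upper[OF assms(1,3,4,2)] adaptive_scan_lower[OF assms(1)] by blast

end
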